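(* For all integers $n,m\ge 0$, $$\phi_{n+m}(x)=\sum_{k=0}^{n}\sum_{j=0}^{m}\binom{n}{k}\genfrac{\{}{\}}{0pt}{}{m}{j}\,j^{\,n-k}\,x^{j}\,\phi_{k}(x)$$ as polynomials in $x$.
   Context: $\genfrac{\{}{\}}{0pt}{}{n}{k}$ denotes the Stirling numbers of the second kind, and $\phi_n(x)=\sum_{k=0}^{n}\genfrac{\{}{\}}{0pt}{}{n}{k}x^k$ is the $n$-th exponential polynomial. Convention: $0^0=1$. *)

theory Defs
  imports "HOL-Combinatorics.Stirling" "HOL-Computational_Algebra.Polynomial"
begin

(* Stirling n k is the library's Stirling number of the second kind. *)
definition exponential_poly :: "nat \<Rightarrow> 'a::comm_semiring_1 poly" where
  "exponential_poly n = (\<Sum>k=0..n. monom (of_nat (Stirling n k)) k)"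

end

theory Submission
  imports Defs
begin

text \<open>
  Put \<open>A\<^sub>j(n) = \<Sum>\<^sub>k C(n,k) j\<^sup>n\<^sup>-\<^sup>k \<phi>\<^sub>k\<close>. The recurrence \<open>\<phi>\<^sub>k\<^sub>+\<^sub>1 = x \<Sum>\<^sub>i C(k,i) \<phi>\<^sub>i\<close> gives
  \<open>A\<^sub>j(n+1) = j A\<^sub>j(n) + x A\<^sub>j\<^sub>+\<^sub>1(n)\<close>. By the recurrence of the Stirling numbers,
  \<open>\<Sum>\<^sub>j S(m,j) x\<^sup>j A\<^sub>j(n)\<close> is therefore unchanged when \<open>(n+1, m)\<close> is replaced by \<open>(n, m+1)\<close>,
  and at \<open>n = 0\<close> it equals \<open>\<phi>\<^sub>m\<close>.
\<close>

text \<open>Pascal's rule, in umbral terms \<open>(c + f)^(n+1) = (c + f)^n * (c + f)\<close>, where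
  \<open>f^k\<close> is read as \<open>f k\<close>.\<close>

lemma binomial_transform_Suc:
  fixes c :: "'a::comm_semiring_1"
  shows "(\<Sum>k\<le>Suc n. of_nat (Suc n choose k) * c ^ (Suc n - k) * f k) =
    (\<Sum>k\<le>n. of_nat (n choose k) * c ^ (n - k) * (c * f k + f (Suc k)))"
proof -
  have split: "(\<Sum>k\<le>Suc n. of_nat (Suc n choose k) * c ^ (Suc n - k) * f k) =
      (c ^ Suc n * f 0 + (\<Sum>k\<le>n. of_nat (n choose Suc k) * c ^ (n - k) * f (Suc k)))
      + (\<Sum>k\<le>n. of_nat (n choose k) * c ^ (n - k) * f (Suc k))"
    by (simp only: sum.atMost_Suc_shift binomial_Suc_Suc of_nat_add sum.distrib
          distrib_right diff_Suc_Suc) (simp add: ac_simps)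
  have "c ^ Suc n * f 0 + (\<Sum>k\<le>n. of_nat (n choose Suc k) * c ^ (n - k) * f (Suc k)) =
      (\<Sum>k\<le>Suc n. of_nat (n choose k) * c ^ (Suc n - k) * f k)"
    by (simp only: sum.atMost_Suc_shift diff_Suc_Suc) simp
  \<comment> \<open>The term \<open>k = Suc n\<close> vanishes because \<open>n choose Suc n\<close>
    is 0; each other term releases one factor \<open>c\<close>.\<close>
  also have "\<dots> = (\<Sum>k\<le>n. of_nat (n choose k) * c ^ (n - k) * (c * f k))"
    by (auto simp: Suc_diff_le mult_ac binomial_eq_0 intro!: sum.cong)
  finally show ?thesis
    by (simp only: split sum.distrib distrib_left)
qed

lemma binomial_transform_Suc_1:
  fixes f :: "nat \<Rightarrow> 'a::comm_semiring_1"
  shows "(\<Sum>k\<le>Suc n. of_nat (Suc n choose k) * f k) =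
    (\<Sum>k\<le>n. of_nat (n choose k) * (f k + f (Suc k)))"
  using binomial_transform_Suc[where c = 1] by simp

text \<open>Umbrally, replacing \<open>f\<close> by \<open>f + 1\<close> inside
  \<open>(c + f)^n\<close> raises the shift to \<open>c + 1\<close>.\<close>

lemma binomial_transform_compose:
  fixes c :: "'a::comm_semiring_1"
  shows "(\<Sum>k\<le>n. of_nat (n choose k) * c ^ (n - k) * (\<Sum>i\<le>k. of_nat (k choose i) * f i)) =
    (\<Sum>k\<le>n. of_nat (n choose k) * (c + 1) ^ (n - k) * f k)"
proof (induction n arbitrary: f)
  case (Suc n)
  \<comment> \<open>The inner bracket is again a transform with shift 1, of the sequence
    \<open>(c + 1) * f i + f (Suc i)\<close>; the induction hypothesis is applied to this
    sequence.\<close>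
  have "c * (\<Sum>i\<le>k. of_nat (k choose i) * f i) + (\<Sum>i\<le>Suc k. of_nat (Suc k choose i) * f i) =
      (\<Sum>i\<le>k. of_nat (k choose i) * ((c + 1) * f i + f (Suc i)))" for k
    by (simp only: binomial_transform_Suc_1 sum_distrib_left)
      (simp add: algebra_simps sum.distrib)
  then show ?case
    by (simp only: binomial_transform_Suc Suc.IH)
qed simp

text \<open>Combinatorially, \<open>i\<close> counts the elements outside the block of a
  distinguished element. The proof instead inducts through the two-term recurrence.\<close>

lemma Stirling_Suc_eq_sum_binomial:
  "Stirling (Suc n) (Suc l) = (\<Sum>i\<le>n. (n choose i) * Stirling i l)"
proof (induction n arbitrary: l)
  case (Suc n)
  have "(\<Sum>i\<le>Suc n. (Suc n choose i) * Stirling i l) =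
      (\<Sum>i\<le>n. (n choose i) * (Stirling i l + Stirling (Suc i) l))"
    using binomial_transform_Suc_1[where f = "\<lambda>i. Stirling i l"] by simp
  also have "\<dots> = Stirling (Suc (Suc n)) (Suc l)"
  proof (cases l)
    case 0
    then show ?thesis by (simp add: Suc.IH[symmetric])
  next
    case (Suc l')
    have "(\<Sum>i\<le>n. (n choose i) * (Stirling i l + Stirling (Suc i) l)) =
        Suc l * (\<Sum>i\<le>n. (n choose i) * Stirling i l) + (\<Sum>i\<le>n. (n choose i) * Stirling i l')"
      by (simp add: Suc algebra_simps sum.distrib sum_distrib_left)
    also have "\<dots> = Stirling (Suc (Suc n)) (Suc l)"
      by (simp only: Suc.IH[symmetric] Stirling.simps Suc)
    finally show ?thesis .
  qed
  finally show ?case by simp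
qed simp

lemma coeff_exponential_poly:
  "coeff (exponential_poly n) l = of_nat (Stirling n l)"
  by (auto simp: exponential_poly_def coeff_sum)

lemma exponential_poly_Suc:
  "(exponential_poly (Suc n) :: 'a::comm_semiring_1 poly) =
    monom 1 1 * (\<Sum>i\<le>n. of_nat (n choose i) * exponential_poly i)"
proof (rule poly_eqI)
  fix l
  show "coeff (exponential_poly (Suc n) :: 'a poly) l =
      coeff (monom 1 1 * (\<Sum>i\<le>n. of_nat (n choose i) * exponential_poly i)) l"
    \<comment> \<open>The two-term recurrence is removed so that
      \<open>Stirling (Suc n) (Suc l)\<close> is rewritten to the binomial sum.\<close>
    by (cases l) (simp_all add: coeff_exponential_poly coeff_monom_mult coeff_sum
        of_nat_poly Stirling_Suc_eq_sum_binomial del: Stirling.simps(4))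
qed

text \<open>The overview's \<open>A\<^sub>j(n)\<close>, umbrally
  \<open>(\<phi> + j)^n\<close>.\<close>

definition shifted_exponential_poly :: "nat \<Rightarrow> nat \<Rightarrow> 'a::comm_semiring_1 poly" where
  "shifted_exponential_poly j n =
    (\<Sum>k\<le>n. of_nat (n choose k) * of_nat j ^ (n - k) * exponential_poly k)"

text \<open>Expanding each \<open>exponential_poly (Suc k)\<close> yields \<open>x\<close> times a
  composed transform, which turns the shift \<open>j\<close> into \<open>j + 1\<close>.\<close>

lemma shifted_exponential_poly_Suc:
  "(shifted_exponential_poly j (Suc n) :: 'a::comm_semiring_1 poly) =
    of_nat j * shifted_exponential_poly j n + monom 1 1 * shifted_exponential_poly (Suc j) n"
proof -
  have "(shifted_exponential_poly j (Suc n) :: 'a poly) =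
      of_nat j * shifted_exponential_poly j n +
      (\<Sum>k\<le>n. of_nat (n choose k) * of_nat j ^ (n - k) * exponential_poly (Suc k))"
    unfolding shifted_exponential_poly_def binomial_transform_Suc
    by (simp add: distrib_left sum.distrib sum_distrib_left mult_ac)
  also have "(\<Sum>k\<le>n. of_nat (n choose k) * of_nat j ^ (n - k) * exponential_poly (Suc k)) =
      monom 1 1 * (\<Sum>k\<le>n. of_nat (n choose k) * (of_nat j :: 'a poly) ^ (n - k) *
        (\<Sum>i\<le>k. of_nat (k choose i) * exponential_poly i))"
    by (simp only: exponential_poly_Suc sum_distrib_left mult_ac)
  also have "\<dots> = monom 1 1 * shifted_exponential_poly (Suc j) n"
    by (simp add: binomial_transform_compose shifted_exponential_poly_def add.commute)
  finally show ?thesis .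
qed

lemma exponential_poly_add:
  "(exponential_poly (n + m) :: 'a::comm_semiring_1 poly) =
    (\<Sum>j\<le>m. of_nat (Stirling m j) * monom 1 j * shifted_exponential_poly j n)"
proof (induction n arbitrary: m)
  case 0
  have "exponential_poly 0 = (1 :: 'a poly)"
    by (simp add: exponential_poly_def)
  then show ?case
    by (simp add: shifted_exponential_poly_def exponential_poly_def[of m] atLeast0AtMost
        of_nat_poly smult_monom)
next
  case (Suc n)
  let ?A = "\<lambda>j. shifted_exponential_poly j n :: 'a poly"
  have "exponential_poly (Suc n + m) =
      (\<Sum>j\<le>Suc m. of_nat (Stirling (Suc m) j) * monom 1 j * ?A j)"
    using Suc.IH[of "Suc m"] by simp
  \<comment> \<open>The term at 0 drops out since \<open>Stirling (Suc m) 0 = 0\<close>.\<close>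
  also have "\<dots> = (\<Sum>j\<le>m. of_nat (Suc j * Stirling m (Suc j)) * monom 1 (Suc j) * ?A (Suc j))
      + (\<Sum>j\<le>m. of_nat (Stirling m j) * monom 1 (Suc j) * ?A (Suc j))"
    by (simp only: sum.atMost_Suc_shift Stirling.simps of_nat_add distrib_right sum.distrib) simp
  \<comment> \<open>The restored term at 0 is killed by its factor \<open>j\<close>; afterwards the
    term at \<open>Suc m\<close> goes because \<open>Stirling m (Suc m) = 0\<close>.\<close>
  also have "(\<Sum>j\<le>m. of_nat (Suc j * Stirling m (Suc j)) * monom 1 (Suc j) * ?A (Suc j)) =
      (\<Sum>j\<le>Suc m. of_nat (j * Stirling m j) * monom 1 j * ?A j)"
    by (simp only: sum.atMost_Suc_shift) simp
  also have "\<dots> = (\<Sum>j\<le>m. of_nat (Stirling m j) * monom 1 j * (of_nat j * ?A j))"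
    by (simp add: mult_ac)
  also have "(\<Sum>j\<le>m. of_nat (Stirling m j) * monom 1 (Suc j) * ?A (Suc j)) =
      (\<Sum>j\<le>m. of_nat (Stirling m j) * monom 1 j * (monom 1 1 * ?A (Suc j)))"
  proof (intro sum.cong refl)
    fix j
    have "monom 1 (Suc j) = (monom 1 j * monom 1 1 :: 'a poly)"
      by (simp add: mult_monom)
    then show "of_nat (Stirling m j) * monom 1 (Suc j) * ?A (Suc j) =
        of_nat (Stirling m j) * monom 1 j * (monom 1 1 * ?A (Suc j))"
      by (simp only: mult.assoc)
  qed
  finally show ?case
    by (simp only: shifted_exponential_poly_Suc distrib_left sum.distrib)
qed

theorem corollary2:
  fixes n m :: nat
  shows "(exponential_poly (n + m) :: 'a::comm_semiring_1 poly) =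
    (\<Sum>k=0..n. \<Sum>j=0..m.
      of_nat ((n choose k) * Stirling m j * j ^ (n - k)) * monom 1 j * exponential_poly k)"
  unfolding exponential_poly_add shifted_exponential_poly_def atLeast0AtMost sum_distrib_left
  by (subst sum.swap) (simp add: mult_ac)

end
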